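(* Let $\mathcal J$ be a finite set of $m\ge 1$ regions, let $\mathbf X_a,\mathbf X_b>0$, and for each $j\in\mathcal J$ let $\beta^m_j>0$, $\varepsilon_j>0$ and $\beta^c_j\in\mathbb R$. Consider the two-player game $\mathcal G$ in which each player $i\in\{a,b\}$ chooses $x^i\in\Omega_i$ so as to maximize $\mathbf u_i(x^i,x^{-i})$, where $$\Omega_i=\Big\{x^i\in\mathbb R^{\mathcal J}_{\ge 0} : \sum_{j\in\mathcal J}x^i_j=\mathbf X_i\Big\},\qquad \mathbf u_i(x^i,x^{-i})=\sum_{j\in\mathcal J}x^i_j\left(\frac{\beta^m_j}{x^i_j+x^{-i}_j+\varepsilon_j}-\beta^c_j\right).$$ Then the game $\mathcal G$ admits a unique Nash equilibrium.
   Context: For $i\in\{a,b\}$, $-i$ denotes the other player. A joint strategy $\overline x=(\overline x^a,\overline x^b)\in\Omega_a\times\Omega_b$ is a (pure) Nash equilibrium of $\mathcal G$ if for all $i\in\{a,b\}$ and all $x^i\in\Omega_i$ one has $\mathbf u_i(\overline x^i,\overline x^{-i})\ge \mathbf u_i(x^i,\overline x^{-i})$. *)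

theory Defs
  imports "HOL-Analysis.Analysis"
begin

datatype player = Player_a | Player_b

fun opponent :: "player \<Rightarrow> player" where
  "opponent Player_a = Player_b"
| "opponent Player_b = Player_a"

text \<open>
  A joint strategy is a function \<open>x\<close> assigning to each player a strategy;
  \<open>u i y z\<close> is the payoff of player \<open>i\<close> when \<open>i\<close> plays \<open>y\<close> and the opponent plays \<open>z\<close>.
\<close>

definition is_nash_equilibrium ::
    "(player \<Rightarrow> 's set) \<Rightarrow> (player \<Rightarrow> 's \<Rightarrow> 's \<Rightarrow> real) \<Rightarrow> (player \<Rightarrow> 's) \<Rightarrow> bool" where
  "is_nash_equilibrium \<Omega> u x \<longleftrightarrow>
     (\<forall>i. x i \<in> \<Omega> i) \<and>
     (\<forall>i. \<forall>y \<in> \<Omega> i. u i (x i) (x (opponent i)) \<ge> u i y (x (opponent i)))"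

text \<open>Regions are the elements of a finite type \<open>'j\<close>; \<open>X i\<close> is the budget of player \<open>i\<close>.\<close>

definition strategies :: "(player \<Rightarrow> real) \<Rightarrow> player \<Rightarrow> (real ^ 'j::finite) set" where
  "strategies X i = {x. (\<forall>j. x $ j \<ge> 0) \<and> (\<Sum>j\<in>UNIV. x $ j) = X i}"

text \<open>
  Both players have the same payoff formula, so the player argument is not used on the
  right-hand side.
\<close>

definition utility ::
    "('j::finite \<Rightarrow> real) \<Rightarrow> ('j \<Rightarrow> real) \<Rightarrow> ('j \<Rightarrow> real) \<Rightarrow>
     player \<Rightarrow> real ^ 'j \<Rightarrow> real ^ 'j \<Rightarrow> real" where
  "utility \<beta>m \<beta>c \<epsilon> i x y =
     (\<Sum>j\<in>UNIV. x $ j * (\<beta>m j / (x $ j + y $ j + \<epsilon> j) - \<beta>c j))"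

end

(*
  Equilibria are the solutions of the variational inequality for the pseudo-gradient of the game,
  because each payoff is concave in the player's own strategy. Brouwer's theorem, applied to a
  pseudo-gradient step followed by the projection onto the compact convex set of joint strategies,
  gives a solution. Within each region the pseudo-gradient is strictly decreasing in the sense of
  Rosen (diagonal strict concavity), which forces two solutions to coincide.
*)

theory Submission
  imports Defs
begin

lemma opponent_opponent [simp]: "opponent (opponent i) = i"
  by (cases i) simp_all

lemma all_player_iff: "(\<forall>i. P i) \<longleftrightarrow> P Player_a \<and> P Player_b"
  by (metis player.exhaust)

section \<open>The strategy sets\<close>

lemma convex_strategies: "convex (strategies X i)"
  unfolding strategies_def convex_def
  by (simp add: sum.distrib flip: sum_distrib_left) (simp flip: distrib_right)

lemma compact_strategies: "compact (strategies X i :: (real ^ 'j::finite) set)"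
proof -
  have "closed {x :: real ^ 'j. (\<forall>j. x $ j \<ge> 0) \<and> (\<Sum>j\<in>UNIV. x $ j) = X i}"
    by (intro closed_Collect_conj closed_Collect_all closed_Collect_le closed_Collect_eq
        continuous_intros)
  \<comment> \<open>A coordinate is at most the sum of all coordinates, as these are
    nonnegative.\<close>
  moreover have "strategies X i \<subseteq> cbox 0 (\<chi> j::'j. X i)"
  proof
    fix x :: "real ^ 'j" assume "x \<in> strategies X i"
    then show "x \<in> cbox 0 (\<chi> j. X i)"
      using member_le_sum[of _ UNIV "($) x"] by (auto simp: strategies_def mem_box_cart)
  qed
  ultimately show ?thesis
    using bounded_subset[OF bounded_cbox] by (simp add: strategies_def compact_eq_bounded_closed)
qed

lemma strategies_nonempty:
  assumes "X i \<ge> 0"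
  shows "strategies X i \<noteq> ({} :: (real ^ 'j::finite) set)"
proof -
  have "(\<chi> j::'j. X i / real CARD('j)) \<in> strategies X i"
    using assms by (simp add: strategies_def)
  then show ?thesis by blast
qed

lemma strategies_nonneg: "x \<in> strategies X i \<Longrightarrow> x $ j \<ge> 0"
  by (simp add: strategies_def)

section \<open>Variational characterization of best responses\<close>

text \<open>The gradient of the payoff in the player's own strategy \<open>x\<close>, with the
  opponent's strategy \<open>y\<close> held fixed.\<close>

definition marginal_utility ::
    "('j::finite \<Rightarrow> real) \<Rightarrow> ('j \<Rightarrow> real) \<Rightarrow> ('j \<Rightarrow> real) \<Rightarrow> real ^ 'j \<Rightarrow> real ^ 'j \<Rightarrow> real ^ 'j" where
  "marginal_utility \<beta>m \<beta>c \<epsilon> x y =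
     (\<chi> j. \<beta>m j * (y $ j + \<epsilon> j) / (x $ j + y $ j + \<epsilon> j)\<^sup>2 - \<beta>c j)"

text \<open>An exact secant formula: the second factor becomes the \<open>j\<close>-th marginal
  utility once \<open>x'\<close> is replaced by \<open>x\<close> in its denominator. Both the
  tangent inequality and the first-order condition are read off from it, with no derivative
  taken.\<close>

lemma utility_diff:
  assumes "\<And>j. \<epsilon> j > 0" "\<And>j. x $ j \<ge> 0" "\<And>j. x' $ j \<ge> 0" "\<And>j. y $ j \<ge> 0"
  shows "utility \<beta>m \<beta>c \<epsilon> i x' y - utility \<beta>m \<beta>c \<epsilon> i x y =
    (\<Sum>j\<in>UNIV. (x' $ j - x $ j) *
       (\<beta>m j * (y $ j + \<epsilon> j) / ((x $ j + y $ j + \<epsilon> j) * (x' $ j + y $ j + \<epsilon> j)) - \<beta>c j))"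
proof -
  have "x' $ j * (\<beta>m j / (x' $ j + y $ j + \<epsilon> j) - \<beta>c j) - x $ j * (\<beta>m j / (x $ j + y $ j + \<epsilon> j) - \<beta>c j) =
    (x' $ j - x $ j) *
       (\<beta>m j * (y $ j + \<epsilon> j) / ((x $ j + y $ j + \<epsilon> j) * (x' $ j + y $ j + \<epsilon> j)) - \<beta>c j)" for j
  proof -
    have "x $ j + y $ j + \<epsilon> j > 0" "x' $ j + y $ j + \<epsilon> j > 0"
      using assms by (simp_all add: add_nonneg_pos)
    then have "x $ j + y $ j + \<epsilon> j \<noteq> 0" "x' $ j + y $ j + \<epsilon> j \<noteq> 0"
      by simp_all
    then show ?thesis
      by (simp add: divide_simps) algebra
  qed
  then show ?thesis
    unfolding utility_def by (simp flip: sum_subtractf)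
qed

lemma utility_diff_le_marginal:
  assumes "\<And>j. \<beta>m j > 0" "\<And>j. \<epsilon> j > 0"
    and "\<And>j. x $ j \<ge> 0" "\<And>j. x' $ j \<ge> 0" "\<And>j. y $ j \<ge> 0"
  shows "utility \<beta>m \<beta>c \<epsilon> i x' y - utility \<beta>m \<beta>c \<epsilon> i x y \<le> marginal_utility \<beta>m \<beta>c \<epsilon> x y \<bullet> (x' - x)"
proof -
  have "(x' $ j - x $ j) *
       (\<beta>m j * (y $ j + \<epsilon> j) / ((x $ j + y $ j + \<epsilon> j) * (x' $ j + y $ j + \<epsilon> j)) - \<beta>c j)
     \<le> (\<beta>m j * (y $ j + \<epsilon> j) / (x $ j + y $ j + \<epsilon> j)\<^sup>2 - \<beta>c j) * (x' $ j - x $ j)" for j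
  proof -
    \<comment> \<open>With \<open>s\<close> and \<open>t\<close> the denominators before and after
      the deviation, \<open>t - s\<close> is the deviation itself, and the gap between tangent and
      secant is a square times a positive factor.\<close>
    define s t k where "s = x $ j + y $ j + \<epsilon> j" and "t = x' $ j + y $ j + \<epsilon> j"
      and "k = \<beta>m j * (y $ j + \<epsilon> j)"
    have pos: "s > 0" "t > 0" "k > 0"
      using assms by (simp_all add: s_def t_def k_def add_nonneg_pos)
    have "(k / s\<^sup>2 - k / (s * t)) * (t - s) = k * (t - s)\<^sup>2 / (s\<^sup>2 * t)"
      using pos by (simp add: field_simps power2_eq_square)
    also have "\<dots> \<ge> 0"
      using pos by simp
    finally have "(t - s) * (k / (s * t) - \<beta>c j) \<le> (k / s\<^sup>2 - \<beta>c j) * (t - s)"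
      by (simp add: algebra_simps)
    then show ?thesis
      by (simp add: s_def t_def k_def)
  qed
  then show ?thesis
    unfolding utility_diff[OF assms(2-5)]
    by (simp add: inner_vec_def marginal_utility_def sum_mono)
qed

text \<open>First-order optimality on a convex set. Necessity comes from small steps along the
  segment towards \<open>x'\<close>, sufficiency from the tangent inequality of a concave
  payoff.\<close>

lemma best_response_iff:
  fixes x y :: "real ^ 'j::finite"
  assumes "\<And>j. \<beta>m j > 0" "\<And>j. \<epsilon> j > 0" "\<And>j. y $ j \<ge> 0" and x: "x \<in> strategies X i"
  shows "(\<forall>x' \<in> strategies X i. utility \<beta>m \<beta>c \<epsilon> i x' y \<le> utility \<beta>m \<beta>c \<epsilon> i x y) \<longleftrightarrow>
         (\<forall>x' \<in> strategies X i. marginal_utility \<beta>m \<beta>c \<epsilon> x y \<bullet> (x' - x) \<le> 0)"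
proof (intro iffI ballI)
  fix x' :: "real ^ 'j" assume max: "\<forall>x' \<in> strategies X i. utility \<beta>m \<beta>c \<epsilon> i x' y \<le> utility \<beta>m \<beta>c \<epsilon> i x y"
    and x': "x' \<in> strategies X i"
  \<comment> \<open>the difference quotient of the utility along the segment from \<open>x\<close> to \<open>x'\<close>\<close>
  define q where "q t = (\<Sum>j\<in>UNIV. (x' $ j - x $ j) * (\<beta>m j * (y $ j + \<epsilon> j) /
     ((x $ j + y $ j + \<epsilon> j) * (x $ j + t * (x' $ j - x $ j) + y $ j + \<epsilon> j)) - \<beta>c j))" for t
  have nz: "x $ j + y $ j + \<epsilon> j \<noteq> 0" for j
    using assms(2,3)[of j] strategies_nonneg[OF x, of j] by linarith
  have "q t \<le> 0" if t: "0 < t" "t < 1" for t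
  proof -
    define z where "z = x + t *\<^sub>R (x' - x)"
    have "z = (1 - t) *\<^sub>R x + t *\<^sub>R x'"
      by (simp add: z_def algebra_simps)
    then have z: "z \<in> strategies X i"
      using convexD_alt[OF convex_strategies x x', of t] t by simp
    \<comment> \<open>Every coordinate of \<open>z - x\<close> carries the factor \<open>t\<close>,
      which comes out of the secant formula.\<close>
    have "t * q t = utility \<beta>m \<beta>c \<epsilon> i z y - utility \<beta>m \<beta>c \<epsilon> i x y"
      unfolding utility_diff[OF assms(2) strategies_nonneg[OF x] strategies_nonneg[OF z] assms(3)]
      by (simp add: q_def z_def sum_distrib_left mult.assoc)
    also have "\<dots> \<le> 0"
      using max z by simp
    finally show ?thesis
      using t by (simp add: mult_le_0_iff)
  qed
  then have "\<forall>\<^sub>F t in at_right 0. q t \<le> 0"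
    unfolding eventually_at_right_field by (metis zero_less_one)
  moreover have "(q \<longlongrightarrow> q 0) (at_right 0)"
    unfolding q_def by (rule tendsto_eq_intros refl | simp add: nz)+
  \<comment> \<open>At \<open>t = 0\<close> the two denominators coincide, so \<open>q 0\<close> is
    the inner product of the marginal utility with \<open>x' - x\<close>.\<close>
  ultimately have "q 0 \<le> 0"
    using tendsto_upperbound trivial_limit_at_right_real by blast
  then show "marginal_utility \<beta>m \<beta>c \<epsilon> x y \<bullet> (x' - x) \<le> 0"
    by (simp add: q_def inner_vec_def marginal_utility_def power2_eq_square mult.commute)
next
  fix x' :: "real ^ 'j" assume "\<forall>x' \<in> strategies X i. marginal_utility \<beta>m \<beta>c \<epsilon> x y \<bullet> (x' - x) \<le> 0"
    and x': "x' \<in> strategies X i"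
  then have "marginal_utility \<beta>m \<beta>c \<epsilon> x y \<bullet> (x' - x) \<le> 0"
    by blast
  moreover have "utility \<beta>m \<beta>c \<epsilon> i x' y - utility \<beta>m \<beta>c \<epsilon> i x y \<le> marginal_utility \<beta>m \<beta>c \<epsilon> x y \<bullet> (x' - x)"
    using assms strategies_nonneg[OF x'] strategies_nonneg[OF x]
    by (intro utility_diff_le_marginal)
  ultimately show "utility \<beta>m \<beta>c \<epsilon> i x' y \<le> utility \<beta>m \<beta>c \<epsilon> i x y"
    by linarith
qed

lemma nash_equilibrium_iff:
  assumes "\<And>j. \<beta>m j > 0" "\<And>j. \<epsilon> j > 0"
  shows "is_nash_equilibrium (strategies X) (utility \<beta>m \<beta>c \<epsilon>) x \<longleftrightarrow>
    (\<forall>i. x i \<in> strategies X i) \<and>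
    (\<forall>i. \<forall>y \<in> strategies X i. marginal_utility \<beta>m \<beta>c \<epsilon> (x i) (x (opponent i)) \<bullet> (y - x i) \<le> 0)"
proof (cases "\<forall>i. x i \<in> strategies X i")
  case True
  have "(\<forall>y \<in> strategies X i.
           utility \<beta>m \<beta>c \<epsilon> i y (x (opponent i)) \<le> utility \<beta>m \<beta>c \<epsilon> i (x i) (x (opponent i))) \<longleftrightarrow>
        (\<forall>y \<in> strategies X i. marginal_utility \<beta>m \<beta>c \<epsilon> (x i) (x (opponent i)) \<bullet> (y - x i) \<le> 0)" for i
    using True strategies_nonneg assms by (intro best_response_iff) blast+
  then show ?thesis
    using True by (simp add: is_nash_equilibrium_def)
next
  case False
  then show ?thesis
    by (auto simp: is_nash_equilibrium_def)
qed

section \<open>Existence\<close>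

text \<open>If \<open>z\<close> is the point of \<open>K\<close> closest to \<open>z + F z\<close>,
  then \<open>F z\<close> makes no acute angle with any direction \<open>w - z\<close> into
  \<open>K\<close>; this is the claimed inequality.\<close>

lemma variational_inequality_solution:
  fixes F :: "'a::euclidean_space \<Rightarrow> 'a"
  assumes "compact K" "convex K" "K \<noteq> {}" "continuous_on K F"
  obtains z where "z \<in> K" "\<And>w. w \<in> K \<Longrightarrow> F z \<bullet> (w - z) \<le> 0"
proof -
  have "closed K"
    using assms(1) by (rule compact_imp_closed)
  define P where "P z = closest_point K (z + F z)" for z
  have "continuous_on K P"
    unfolding P_def
    using continuous_on_compose2[OF continuous_on_closest_point[OF assms(2) \<open>closed K\<close> assms(3), of UNIV],
        of K "\<lambda>z. z + F z"] assms(4) by (simp add: continuous_on_add continuous_on_id)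
  moreover have "P \<in> K \<rightarrow> K"
    using closest_point_in_set[OF \<open>closed K\<close> assms(3)] by (simp add: P_def)
  ultimately obtain z where "z \<in> K" "P z = z"
    using brouwer[OF assms(1-3)] by blast
  moreover have "F z \<bullet> (w - z) \<le> 0" if "w \<in> K" for w
    using closest_point_dot[OF assms(2) \<open>closed K\<close> that, of "z + F z"] \<open>P z = z\<close>
    by (simp add: P_def)
  ultimately show ?thesis
    using that by blast
qed

lemma nash_equilibrium_exists:
  fixes \<beta>m \<beta>c \<epsilon> :: "'j::finite \<Rightarrow> real"
  assumes "\<And>i. X i \<ge> 0" "\<And>j. \<beta>m j > 0" "\<And>j. \<epsilon> j > 0"
  shows "\<exists>x :: player \<Rightarrow> real ^ 'j. is_nash_equilibrium (strategies X) (utility \<beta>m \<beta>c \<epsilon>) x"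
proof -
  \<comment> \<open>Joint strategies become pairs so that they lie in a Euclidean space;
    \<open>case_player a b\<close> later turns the solution back into a function.\<close>
  define K :: "((real ^ 'j) \<times> (real ^ 'j)) set" where "K = strategies X Player_a \<times> strategies X Player_b"
  define F where "F z = (marginal_utility \<beta>m \<beta>c \<epsilon> (fst z) (snd z),
                         marginal_utility \<beta>m \<beta>c \<epsilon> (snd z) (fst z))"
    for z :: "(real ^ 'j) \<times> (real ^ 'j)"
  have nz: "fst z $ j + snd z $ j + \<epsilon> j \<noteq> 0" "snd z $ j + fst z $ j + \<epsilon> j \<noteq> 0" if "z \<in> K" for z j
  proof -
    have "fst z $ j \<ge> 0" "snd z $ j \<ge> 0"
      using that by (auto simp: K_def strategies_nonneg)
    then show "fst z $ j + snd z $ j + \<epsilon> j \<noteq> 0" "snd z $ j + fst z $ j + \<epsilon> j \<noteq> 0"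
      using assms(3)[of j] by linarith+
  qed
  have "continuous_on K F"
    unfolding F_def marginal_utility_def
    by (intro continuous_intros) (simp_all add: nz)
  moreover have "compact K" "convex K"
    by (simp_all add: K_def compact_Times convex_Times compact_strategies convex_strategies)
  moreover have "K \<noteq> {}"
    by (simp add: K_def strategies_nonempty assms(1))
  ultimately obtain z where z: "z \<in> K" and vi: "\<And>w. w \<in> K \<Longrightarrow> F z \<bullet> (w - z) \<le> 0"
    using variational_inequality_solution by blast
  obtain a b where ab: "z = (a, b)" by fastforce
  \<comment> \<open>Test points that change only one component split the joint inequality into one
    per player.\<close>
  have "marginal_utility \<beta>m \<beta>c \<epsilon> a b \<bullet> (y - a) \<le> 0" if "y \<in> strategies X Player_a" for y
    using vi[of "(y, b)"] z that by (simp add: ab K_def F_def)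
  moreover have "marginal_utility \<beta>m \<beta>c \<epsilon> b a \<bullet> (y - b) \<le> 0" if "y \<in> strategies X Player_b" for y
    using vi[of "(a, y)"] z that by (simp add: ab K_def F_def)
  ultimately have "is_nash_equilibrium (strategies X) (utility \<beta>m \<beta>c \<epsilon>) (case_player a b)"
    using z unfolding nash_equilibrium_iff[OF assms(2,3)] all_player_iff
    by (simp add: ab K_def)
  then show ?thesis by blast
qed

section \<open>Uniqueness\<close>

text \<open>The contribution of one region, with \<open>\<beta>m\<close> factored out and
  \<open>\<beta>c\<close> cancelled. Over the common denominator, the numerator is a positive main
  term minus a cross term that the main term dominates.\<close>

lemma pseudo_gradient_strictly_monotone:
  fixes x y x' y' e :: real
  assumes nonneg: "x \<ge> 0" "y \<ge> 0" "x' \<ge> 0" "y' \<ge> 0" and "e > 0"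
    and neq: "x \<noteq> x' \<or> y \<noteq> y'"
  shows "((y + e) / (x + y + e)\<^sup>2 - (y' + e) / (x' + y' + e)\<^sup>2) * (x' - x) +
         ((x + e) / (x + y + e)\<^sup>2 - (x' + e) / (x' + y' + e)\<^sup>2) * (y' - y) > 0"
proof -
  \<comment> \<open>Midpoint coordinates: \<open>y + e\<close> and \<open>y' + e\<close> are
    \<open>P - E / 2\<close> and \<open>P + E / 2\<close>, likewise \<open>x + e\<close> and
    \<open>x' + e\<close> with \<open>Q\<close> and \<open>D\<close>; moreover
    \<open>s' - s = D + E\<close>.\<close>
  define s s' D E P Q where "s = x + y + e" and "s' = x' + y' + e"
    and "D = x' - x" and "E = y' - y" and "P = (y + y') / 2 + e" and "Q = (x + x') / 2 + e"
  note defs = s_def s'_def D_def E_def P_def Q_def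
  have pos: "s > 0" "s' > 0"
    using assms by (simp_all add: defs)
  have P: "P \<ge> \<bar>E\<bar> / 2 + e" and Q: "Q \<ge> \<bar>D\<bar> / 2 + e" and S: "s + s' \<ge> \<bar>D + E\<bar>"
    using nonneg \<open>e > 0\<close> by (auto simp: defs abs_if field_simps)
  have "D \<noteq> 0 \<or> E \<noteq> 0"
    using neq by (auto simp: defs)
  then have DE: "D\<^sup>2 + E\<^sup>2 > 0"
    by (simp add: sum_power2_gt_zero_iff)
  \<comment> \<open>Since \<open>P + Q = (s + s') / 2 + e\<close>, only \<open>e\<close> survives as
    the coefficient of \<open>D * E\<close> in the part of the numerator divisible by
    \<open>s + s'\<close>.\<close>
  define R where "R = P * D\<^sup>2 + Q * E\<^sup>2 + e * (D * E)"
  \<comment> \<open>The mixed term \<open>2 * e * (D * E)\<close> is at least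
    \<open>- e * (D\<^sup>2 + E\<^sup>2)\<close>, which uses up half of what the summands
    \<open>e\<close> in the bounds for \<open>P\<close> and \<open>Q\<close> provide; the other half
    makes the final inequality strict.\<close>
  have "R * 2 \<ge> \<bar>D * E\<bar> * (\<bar>D\<bar> + \<bar>E\<bar>) + e * (D\<^sup>2 + E\<^sup>2)"
  proof -
    have "P * D\<^sup>2 \<ge> (\<bar>E\<bar> / 2 + e) * D\<^sup>2" "Q * E\<^sup>2 \<ge> (\<bar>D\<bar> / 2 + e) * E\<^sup>2"
      using P Q by (simp_all add: mult_right_mono)
    moreover have "e * (D + E)\<^sup>2 \<ge> 0"
      using \<open>e > 0\<close> by simp
    moreover have "\<bar>E\<bar> * D\<^sup>2 + \<bar>D\<bar> * E\<^sup>2 = \<bar>D * E\<bar> * (\<bar>D\<bar> + \<bar>E\<bar>)"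
      unfolding abs_mult power2_abs[of D, symmetric] power2_abs[of E, symmetric] by algebra
    ultimately show ?thesis
      unfolding R_def by (simp add: algebra_simps power2_eq_square)
  qed
  moreover have "e * (D\<^sup>2 + E\<^sup>2) > 0"
    using DE \<open>e > 0\<close> by simp
  moreover have "\<bar>D * E\<bar> * (\<bar>D\<bar> + \<bar>E\<bar>) \<ge> \<bar>D * E\<bar> * \<bar>D + E\<bar>"
    by (intro mult_left_mono) auto
  ultimately have R: "R * 2 > \<bar>D * E\<bar> * \<bar>D + E\<bar>"
    by linarith
  \<comment> \<open>One factor \<open>\<bar>D + E\<bar>\<close> is traded for \<open>s + s'\<close>;
    the remaining product is what \<open>R * 2\<close> exceeds.\<close>
  have "D * E * (D + E)\<^sup>2 \<le> \<bar>D * E\<bar> * \<bar>D + E\<bar> * \<bar>D + E\<bar>"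
    using mult_right_mono[OF abs_ge_self[of "D * E"], of "(D + E)\<^sup>2"]
    by (simp add: power2_eq_square mult.assoc)
  also have "\<dots> \<le> \<bar>D * E\<bar> * \<bar>D + E\<bar> * (s + s')"
    using S by (intro mult_left_mono) auto
  also have "\<dots> < R * 2 * (s + s')"
    using R pos by (intro mult_strict_right_mono) auto
  finally have num: "(s + s') * R - D * E * (D + E)\<^sup>2 / 2 > 0"
    by (simp add: algebra_simps)
  have "((y + e) * s'\<^sup>2 - (y' + e) * s\<^sup>2) * D + ((x + e) * s'\<^sup>2 - (x' + e) * s\<^sup>2) * E =
    (s + s') * R - D * E * (D + E)\<^sup>2 / 2"
    unfolding R_def defs by (simp add: field_simps power2_eq_square)
  moreover have "((y + e) / s\<^sup>2 - (y' + e) / s'\<^sup>2) * D + ((x + e) / s\<^sup>2 - (x' + e) / s'\<^sup>2) * E =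
    (((y + e) * s'\<^sup>2 - (y' + e) * s\<^sup>2) * D + ((x + e) * s'\<^sup>2 - (x' + e) * s\<^sup>2) * E) / (s\<^sup>2 * s'\<^sup>2)"
    using pos by (simp add: field_simps)
  ultimately show ?thesis
    using num pos by (simp add: s_def s'_def D_def E_def)
qed

text \<open>Both players share the weight \<open>\<beta>m j\<close> in region \<open>j\<close>, so
  the expression is a positively weighted sum of one-region terms. Regions where the two profiles
  agree contribute 0, and they differ in at least one.\<close>

lemma marginal_utility_strictly_monotone:
  fixes \<beta>m \<beta>c \<epsilon> :: "'j::finite \<Rightarrow> real"
  assumes "\<And>j. \<beta>m j > 0" "\<And>j. \<epsilon> j > 0"
    and nonneg: "\<And>j. x $ j \<ge> 0" "\<And>j. y $ j \<ge> 0" "\<And>j. x' $ j \<ge> 0" "\<And>j. y' $ j \<ge> 0"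
    and neq: "x \<noteq> x' \<or> y \<noteq> y'"
  shows "(marginal_utility \<beta>m \<beta>c \<epsilon> x y - marginal_utility \<beta>m \<beta>c \<epsilon> x' y') \<bullet> (x' - x) +
         (marginal_utility \<beta>m \<beta>c \<epsilon> y x - marginal_utility \<beta>m \<beta>c \<epsilon> y' x') \<bullet> (y' - y) > 0"
proof -
  define h where "h j =
    ((y $ j + \<epsilon> j) / (x $ j + y $ j + \<epsilon> j)\<^sup>2 - (y' $ j + \<epsilon> j) / (x' $ j + y' $ j + \<epsilon> j)\<^sup>2) * (x' $ j - x $ j) +
    ((x $ j + \<epsilon> j) / (x $ j + y $ j + \<epsilon> j)\<^sup>2 - (x' $ j + \<epsilon> j) / (x' $ j + y' $ j + \<epsilon> j)\<^sup>2) * (y' $ j - y $ j)" for j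
  have pos: "h j > 0" if "x $ j \<noteq> x' $ j \<or> y $ j \<noteq> y' $ j" for j
    unfolding h_def using assms that by (intro pseudo_gradient_strictly_monotone) auto
  moreover have "h j = 0" if "\<not> (x $ j \<noteq> x' $ j \<or> y $ j \<noteq> y' $ j)" for j
    using that by (simp add: h_def)
  ultimately have "h j \<ge> 0" for j
    by (metis order.refl less_imp_le)
  moreover obtain k where "x $ k \<noteq> x' $ k \<or> y $ k \<noteq> y' $ k"
    using neq by (auto simp: vec_eq_iff)
  ultimately have "(\<Sum>j\<in>UNIV. \<beta>m j * h j) > 0"
    using pos assms(1) by (intro sum_pos2[of _ k]) (auto simp: less_imp_le)
  also have "(\<Sum>j\<in>UNIV. \<beta>m j * h j) =
    (marginal_utility \<beta>m \<beta>c \<epsilon> x y - marginal_utility \<beta>m \<beta>c \<epsilon> x' y') \<bullet> (x' - x) +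
    (marginal_utility \<beta>m \<beta>c \<epsilon> y x - marginal_utility \<beta>m \<beta>c \<epsilon> y' x') \<bullet> (y' - y)"
    unfolding inner_vec_def marginal_utility_def h_def
    by (simp add: add.commute[of "y $ _" "x $ _"] add.commute[of "y' $ _" "x' $ _"]
        algebra_simps flip: sum.distrib)
  finally show ?thesis .
qed

lemma nash_equilibrium_unique:
  fixes \<beta>m \<beta>c \<epsilon> :: "'j::finite \<Rightarrow> real" and x x' :: "player \<Rightarrow> real ^ 'j"
  assumes "\<And>j. \<beta>m j > 0" "\<And>j. \<epsilon> j > 0"
    and x: "is_nash_equilibrium (strategies X) (utility \<beta>m \<beta>c \<epsilon>) x"
    and x': "is_nash_equilibrium (strategies X) (utility \<beta>m \<beta>c \<epsilon>) x'"
  shows "x = x'"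
proof (rule ccontr)
  let ?G = "\<lambda>x i. marginal_utility \<beta>m \<beta>c \<epsilon> (x i) (x (opponent i))"
  assume "x \<noteq> x'"
  then have neq: "x Player_a \<noteq> x' Player_a \<or> x Player_b \<noteq> x' Player_b"
    by (metis ext player.exhaust)
  have mem: "x i \<in> strategies X i" "x' i \<in> strategies X i" for i
    using x x' by (simp_all add: is_nash_equilibrium_def)
  \<comment> \<open>Each equilibrium is tested against the other; adding the two inequalities, and
    then the two players, contradicts strict monotonicity.\<close>
  have "?G x i \<bullet> (x' i - x i) \<le> 0" "?G x' i \<bullet> (x i - x' i) \<le> 0" for i
    using x x' mem by (simp_all add: nash_equilibrium_iff assms(1,2))
  then have "(?G x i - ?G x' i) \<bullet> (x' i - x i) \<le> 0" for i
    by (smt (verit) inner_diff_left inner_diff_right)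
  from this[of Player_a] this[of Player_b] show False
    using marginal_utility_strictly_monotone[of \<beta>m \<epsilon> "x Player_a" "x Player_b" "x' Player_a"
        "x' Player_b" \<beta>c] neq assms(1,2) strategies_nonneg[OF mem(1)] strategies_nonneg[OF mem(2)]
    by fastforce
qed

theorem theorem1:
  fixes X :: "player \<Rightarrow> real"
    and \<beta>m \<beta>c \<epsilon> :: "'j::finite \<Rightarrow> real"
  assumes "\<And>i. X i > 0"
    and "\<And>j. \<beta>m j > 0"
    and "\<And>j. \<epsilon> j > 0"
  shows "\<exists>!x :: player \<Rightarrow> real ^ 'j.
           is_nash_equilibrium (strategies X) (utility \<beta>m \<beta>c \<epsilon>) x"
proof (rule ex_ex1I)
  show "\<exists>x :: player \<Rightarrow> real ^ 'j. is_nash_equilibrium (strategies X) (utility \<beta>m \<beta>c \<epsilon>) x"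
    using assms by (intro nash_equilibrium_exists) (simp_all add: less_imp_le)
next
  fix x x' :: "player \<Rightarrow> real ^ 'j"
  assume "is_nash_equilibrium (strategies X) (utility \<beta>m \<beta>c \<epsilon>) x"
    and "is_nash_equilibrium (strategies X) (utility \<beta>m \<beta>c \<epsilon>) x'"
  then show "x = x'"
    by (rule nash_equilibrium_unique[OF assms(2,3)])
qed

end
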